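(* Let $K$ be a convex body in $\mathbb{R}^n$ and let $\nu_1,\nu_2,\dots$ be orthonormal slicing directions in $\mathbb{R}^n$. For every $1\le k\le n-1$, with $\boldsymbol{\nu}_k=(\nu_1,\dots,\nu_k)$, the $k$-th iterated slicing support function satisfies, for all $u\in E_{n-k}$ and $\mathbf{p}_k=(p_1,\dots,p_k)\in\mathbb{R}^k$, $$h^{(k)}_{\boldsymbol{\nu}_k}(u,\mathbf{p}_k)=\inf_{\boldsymbol{\lambda}\in\mathbb{R}^k}\Bigl(h_K\Bigl(u+\sum_{j=1}^k\lambda_j\nu_j\Bigr)-\sum_{j=1}^k\lambda_jp_j\Bigr).$$ Moreover, for $2\le k\le n-1$, it satisfies $$h^{(k)}_{(\boldsymbol{\tilde\nu},\nu_k)}(u,\mathbf{p}_k)=\inf_{\lambda_k\in\mathbb{R}}\Bigl(h^{(k-1)}_{\boldsymbol{\tilde\nu}}(u+\lambda_k\nu_k,\mathbf{p}_{k-1})-\lambda_kp_k\Bigr),$$ where $\boldsymbol{\tilde\nu}=(\nu_1,\dots,\nu_{k-1})$, $(\boldsymbol{\tilde\nu},\nu_k)=\boldsymbol{\nu}_k$ and $\mathbf{p}_{k-1}=(p_1,\dots,p_{k-1})$.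
   Context: The support function is $h_K(v)=\sup_{x\in K}x\cdot v$, $v\in\mathbb{R}^n$. For an orthonormal family $\nu_1,\dots,\nu_k\in\mathbb{R}^n$, $1\le k\le n-1$, let $E_{n-k}=\operatorname{span}\{\nu_1,\dots,\nu_k\}^\perp$. For $\mathbf{p}_k=(p_1,\dots,p_k)\in\mathbb{R}^k$ let $K^{(k)}(\boldsymbol{\nu}_k,\mathbf{p}_k)=K\cap\bigcap_{j=1}^k\{x\in\mathbb{R}^n:x\cdot\nu_j=p_j\}$. The $k$-th iterated slicing support function is $h^{(k)}_{\boldsymbol{\nu}_k}(u,\mathbf{p}_k)=\sup_{x\in K^{(k)}(\boldsymbol{\nu}_k,\mathbf{p}_k)}x\cdot u$ for $u\in E_{n-k}$, with the convention $h^{(k)}_{\boldsymbol{\nu}_k}(u,\mathbf{p}_k)=-\infty$ if $K^{(k)}(\boldsymbol{\nu}_k,\mathbf{p}_k)=\emptyset$. *)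

theory Defs
  imports "HOL-Analysis.Analysis"
begin

definition convex_body :: "'a::euclidean_space set \<Rightarrow> bool" where
  "convex_body K \<longleftrightarrow> K \<noteq> {} \<and> compact K \<and> convex K"

text \<open>Support functions take values in the extended reals, so that the supremum over the
  empty set is \<open>-\<infinity>\<close>.\<close>

definition support_fun :: "'a::euclidean_space set \<Rightarrow> 'a \<Rightarrow> ereal" where
  "support_fun K v = (SUP x\<in>K. ereal (x \<bullet> v))"

definition orthonormal_family :: "'i set \<Rightarrow> ('i \<Rightarrow> 'a::euclidean_space) \<Rightarrow> bool" where
  "orthonormal_family I \<nu> \<longleftrightarrow> (\<forall>i\<in>I. \<forall>j\<in>I. \<nu> i \<bullet> \<nu> j = (if i = j then 1 else 0))"

text \<open>Tuples \<open>(\<nu>\<^sub>1, \<dots>, \<nu>\<^sub>k)\<close> and \<open>(p\<^sub>1, \<dots>, p\<^sub>k)\<close> are functions on \<open>nat\<close> of which only the values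
  on \<open>{1..k}\<close> matter; the initial subtuples of length \<open>k - 1\<close> are thus given by the same
  functions together with \<open>k - 1\<close>.\<close>

definition slice_space :: "nat \<Rightarrow> (nat \<Rightarrow> 'a::euclidean_space) \<Rightarrow> 'a set" where
  "slice_space k \<nu> = orthogonal_comp (span (\<nu> ` {1..k}))"

definition iter_slice ::
    "'a::euclidean_space set \<Rightarrow> nat \<Rightarrow> (nat \<Rightarrow> 'a) \<Rightarrow> (nat \<Rightarrow> real) \<Rightarrow> 'a set" where
  "iter_slice K k \<nu> p = K \<inter> (\<Inter>j\<in>{1..k}. {x. x \<bullet> \<nu> j = p j})"

definition slicing_support_fun ::
    "'a::euclidean_space set \<Rightarrow> nat \<Rightarrow> (nat \<Rightarrow> 'a) \<Rightarrow> 'a \<Rightarrow> (nat \<Rightarrow> real) \<Rightarrow> ereal" where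
  "slicing_support_fun K k \<nu> u p = support_fun (iter_slice K k \<nu> p) u"

end

theory Submission
  imports Defs
begin

text \<open>A fiber \<open>K \<inter> {x. L x = y}\<close> of a linear map satisfies a Lagrangian duality for its support
  function: weak duality is immediate, and if \<open>t\<close> exceeds the support function of the fiber at \<open>u\<close>,
  then the compact convex image of \<open>K\<close> under \<open>x \<mapsto> (x \<bullet> u, L x)\<close> misses the closed ray
  \<open>[t, \<infinity>) \<times> {y}\<close>, and a strictly separating hyperplane yields the multiplier. If that hyperplane is
  vertical the fiber is empty, and a large multiple of its normal works because \<open>K\<close> is bounded.
  The \<open>k\<close>-fold formula is the case \<open>L x = \<Sum>j. (x \<bullet> \<nu> j) *\<^sub>R \<nu> j\<close>, the recursive one is the case
  \<open>L x = x \<bullet> \<nu> k\<close> with the \<open>(k - 1)\<close>-st slice in place of \<open>K\<close>.\<close>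

lemma fiber_multiplier_exists:
  fixes L :: "'a::euclidean_space \<Rightarrow> 'b::euclidean_space"
  assumes K: "compact K" "convex K" and L: "linear L"
    and less: "\<And>x. x \<in> K \<Longrightarrow> L x = y \<Longrightarrow> x \<bullet> u < t"
  obtains w where "\<And>x. x \<in> K \<Longrightarrow> x \<bullet> u + L x \<bullet> w \<le> t + y \<bullet> w"
proof (cases "K = {}")
  case True
  then show ?thesis using that by blast
next
  case False
  define f where "f x = (x \<bullet> u, L x)" for x
  have lin: "linear f"
    unfolding f_def using L
    by (auto intro!: linearI simp: inner_add_left linear_add linear_scale)
  have "compact (f ` K)"
    using K(1) lin by (intro compact_continuous_image linear_continuous_on) (auto simp: linear_linear)
  moreover have "convex (f ` K)"
    using K(2) lin by (rule convex_linear_image[rotated])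
  moreover have "closed ({t..} \<times> {y})" "convex ({t..} \<times> {y})"
    by (auto intro: closed_Times convex_Times)
  moreover have "f ` K \<inter> ({t..} \<times> {y}) = {}"
    using less by (fastforce simp: f_def)
  ultimately obtain a b where
    K_below: "\<And>z. z \<in> f ` K \<Longrightarrow> a \<bullet> z < b" and ray_above: "\<And>z. z \<in> {t..} \<times> {y} \<Longrightarrow> b < a \<bullet> z"
    using separating_hyperplane_compact_closed[of "f ` K" "{t..} \<times> {y}"] False by blast
  obtain \<alpha> \<beta> where a: "a = (\<alpha>, \<beta>)" by (cases a)
  have below: "\<alpha> * (x \<bullet> u) + \<beta> \<bullet> L x < b" if "x \<in> K" for x
    using K_below[of "f x"] that by (simp add: a f_def)
  have above: "b < \<alpha> * s + \<beta> \<bullet> y" if "t \<le> s" for s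
    using ray_above[of "(s, y)"] that by (simp add: a)
  \<comment> \<open>The ray is unbounded in its first coordinate. With \<alpha> negative, the point
    \<open>s\<close> lies on it and \<open>\<alpha> * s + \<beta> \<bullet> y\<close> has already
    fallen to at most \<open>b\<close>.\<close>
  have "0 \<le> \<alpha>"
  proof (rule ccontr)
    assume neg: "\<not> 0 \<le> \<alpha>"
    define s where "s = max t ((b - \<beta> \<bullet> y) / \<alpha>)"
    have "\<alpha> * s \<le> \<alpha> * ((b - \<beta> \<bullet> y) / \<alpha>)"
      using neg by (intro mult_left_mono_neg) (auto simp: s_def)
    also have "\<dots> = b - \<beta> \<bullet> y" using neg by simp
    finally show False using above[of s] by (simp add: s_def)
  qed
  then consider "0 < \<alpha>" | "\<alpha> = 0" by linarith
  then show ?thesis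
  proof cases
    case 1
    \<comment> \<open>Separation at the tip \<open>(t, y)\<close> of the ray, divided by \<alpha>,
      is the claim.\<close>
    have "x \<bullet> u + L x \<bullet> (\<beta> /\<^sub>R \<alpha>) \<le> t + y \<bullet> (\<beta> /\<^sub>R \<alpha>)" if "x \<in> K" for x
    proof -
      have "\<alpha> * (x \<bullet> u) + \<beta> \<bullet> L x \<le> \<alpha> * t + \<beta> \<bullet> y"
        using below[OF that] above[of t] by simp
      with 1 have "\<alpha> * (x \<bullet> u + L x \<bullet> (\<beta> /\<^sub>R \<alpha>)) \<le> \<alpha> * (t + y \<bullet> (\<beta> /\<^sub>R \<alpha>))"
        by (simp add: distrib_left inner_commute mult.assoc[symmetric])
      with 1 show ?thesis by simp
    qed
    then show ?thesis by (rule that)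
  next
    case 2
    \<comment> \<open>For a vertical hyperplane \<beta> alone separates \<open>y\<close> from the
      image of \<open>K\<close> under \<open>L\<close>, with a gap of at least \<open>d\<close>. The
      multiple \<open>N\<close> makes this gap outweigh the largest possible excess of
      \<open>x \<bullet> u\<close> over \<open>t\<close>; the maximum with 0 lets \<open>N\<close>
      scale inequalities.\<close>
    define d where "d = \<beta> \<bullet> y - b"
    have d: "0 < d" using above[of t] 2 by (simp add: d_def)
    obtain B where B: "\<And>x. x \<in> K \<Longrightarrow> norm x \<le> B"
      using compact_imp_bounded[OF K(1)] by (auto simp: bounded_iff)
    define N where "N = max 0 ((B * norm u - t) / d)"
    have N: "0 \<le> N" "B * norm u - t \<le> N * d"
      using d by (auto simp: N_def pos_divide_le_eq[symmetric])
    have "x \<bullet> u + L x \<bullet> (N *\<^sub>R \<beta>) \<le> t + y \<bullet> (N *\<^sub>R \<beta>)" if "x \<in> K" for x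
    proof -
      have "x \<bullet> u \<le> norm x * norm u" by (rule norm_cauchy_schwarz)
      also have "\<dots> \<le> B * norm u" using B[OF that] by (simp add: mult_right_mono)
      also have "\<dots> \<le> t + N * d" using N by simp
      also have "N * d \<le> N * (\<beta> \<bullet> y - \<beta> \<bullet> L x)"
        using N(1) below[OF that] 2 by (intro mult_left_mono) (auto simp: d_def)
      finally show ?thesis by (simp add: algebra_simps inner_commute)
    qed
    then show ?thesis by (rule that)
  qed
qed

text \<open>Duality with \<open>w\<close> as Lagrange multiplier for \<open>L x = y\<close> and
  \<open>L'\<close> the adjoint of \<open>L\<close>. It also covers an empty fiber or an empty
  \<open>K\<close>, both sides then being -\<infinity>; slices put in place of \<open>K\<close> can
  be empty.\<close>

lemma support_fun_fiber:
  fixes L :: "'a::euclidean_space \<Rightarrow> 'b::euclidean_space"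
  assumes K: "compact K" "convex K" and L: "linear L"
    and adj: "\<And>x w. L x \<bullet> w = x \<bullet> L' w"
  shows "support_fun (K \<inter> {x. L x = y}) u = (INF w. support_fun K (u + L' w) - ereal (y \<bullet> w))"
proof (rule antisym)
  show "support_fun (K \<inter> {x. L x = y}) u \<le> (INF w. support_fun K (u + L' w) - ereal (y \<bullet> w))"
  proof (rule INF_greatest)
    fix w
    have "ereal (x \<bullet> u) \<le> support_fun K (u + L' w) - ereal (y \<bullet> w)"
      if "x \<in> K" "L x = y" for x
    proof -
      have "ereal (x \<bullet> u) = ereal (x \<bullet> (u + L' w)) - ereal (y \<bullet> w)"
        using adj[of x w] that by (simp add: inner_add_right)
      also have "\<dots> \<le> support_fun K (u + L' w) - ereal (y \<bullet> w)"
        unfolding support_fun_def using that by (intro ereal_minus_mono SUP_upper) auto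
      finally show ?thesis .
    qed
    then show "support_fun (K \<inter> {x. L x = y}) u \<le> support_fun K (u + L' w) - ereal (y \<bullet> w)"
      unfolding support_fun_def[of "K \<inter> _"] by (intro SUP_least) auto
  qed
next
  show "(INF w. support_fun K (u + L' w) - ereal (y \<bullet> w)) \<le> support_fun (K \<inter> {x. L x = y}) u"
  \<comment> \<open>Approaching from strictly above supplies the strict inequality that separation
    needs, and treats the value -\<infinity> uniformly.\<close>
  proof (rule dense_ge)
    fix T assume T: "support_fun (K \<inter> {x. L x = y}) u < T"
    show "(INF w. support_fun K (u + L' w) - ereal (y \<bullet> w)) \<le> T"
    proof (cases T)
      case (real t)
      have less: "x \<bullet> u < t" if "x \<in> K" "L x = y" for x
      proof -
        have "ereal (x \<bullet> u) \<le> support_fun (K \<inter> {x. L x = y}) u"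
          unfolding support_fun_def using that by (intro SUP_upper) auto
        also note T
        finally show ?thesis by (simp add: real)
      qed
      obtain w where w: "\<And>x. x \<in> K \<Longrightarrow> x \<bullet> u + L x \<bullet> w \<le> t + y \<bullet> w"
        using fiber_multiplier_exists[OF K L less] by blast
      have "support_fun K (u + L' w) \<le> ereal (t + y \<bullet> w)"
        unfolding support_fun_def using w adj by (intro SUP_least) (simp add: inner_add_right)
      then have "support_fun K (u + L' w) - ereal (y \<bullet> w) \<le> ereal (t + y \<bullet> w) - ereal (y \<bullet> w)"
        by (rule ereal_minus_mono) simp
      then show ?thesis by (intro INF_lower2[of w]) (auto simp: real)
    qed (use T in auto)
  qed
qed

lemma compact_iter_slice: "compact K \<Longrightarrow> compact (iter_slice K k \<nu> p)"
  unfolding iter_slice_def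
  by (intro compact_Int_closed closed_INT) (auto simp: closed_hyperplane inner_commute[of _ "\<nu> _"])

lemma convex_iter_slice: "convex K \<Longrightarrow> convex (iter_slice K k \<nu> p)"
  unfolding iter_slice_def
  by (intro convex_Int convex_INT) (auto simp: convex_hyperplane inner_commute[of _ "\<nu> _"])

lemma iter_slice_Suc: "iter_slice K (Suc k) \<nu> p = iter_slice K k \<nu> p \<inter> {x. x \<bullet> \<nu> (Suc k) = p (Suc k)}"
  unfolding iter_slice_def by (auto simp: atLeastAtMostSuc_conv)

lemma slicing_support_fun_Suc:
  assumes "compact K" "convex K"
  shows "slicing_support_fun K (Suc k) \<nu> u p =
    (INF l. slicing_support_fun K k \<nu> (u + l *\<^sub>R \<nu> (Suc k)) p - ereal (l * p (Suc k)))"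
  using support_fun_fiber[OF compact_iter_slice convex_iter_slice, OF assms,
      of "\<lambda>x. x \<bullet> \<nu> (Suc k)" "\<lambda>l. l *\<^sub>R \<nu> (Suc k)" k \<nu> p "p (Suc k)" u]
  by (simp add: slicing_support_fun_def iter_slice_Suc mult.commute bounded_linear.linear
      bounded_linear_inner_left)

lemma orthonormal_family_inner_sum:
  assumes "orthonormal_family I \<nu>" "finite I" "i \<in> I"
  shows "(\<Sum>j\<in>I. c j *\<^sub>R \<nu> j) \<bullet> \<nu> i = c i"
proof -
  have "(\<Sum>j\<in>I. c j *\<^sub>R \<nu> j) \<bullet> \<nu> i = (\<Sum>j\<in>I. if j = i then c j else 0)"
    using assms(1,3) by (auto simp: inner_sum_left orthonormal_family_def intro!: sum.cong)
  with assms(2,3) show ?thesis by simp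
qed

text \<open>\<open>L\<close> is the orthogonal projection onto the span of the directions, hence its
  own adjoint. Taking values in the ambient space avoids a type of dimension
  \<open>k\<close>.\<close>

lemma slicing_support_fun_eq_INF:
  assumes K: "compact K" "convex K" and \<nu>: "orthonormal_family {1..k} \<nu>"
  shows "slicing_support_fun K k \<nu> u p = (INF l \<in> {1..k} \<rightarrow>\<^sub>E UNIV.
    support_fun K (u + (\<Sum>j=1..k. l j *\<^sub>R \<nu> j)) - ereal (\<Sum>j=1..k. l j * p j))"
proof -
  define L where "L x = (\<Sum>j=1..k. (x \<bullet> \<nu> j) *\<^sub>R \<nu> j)" for x
  define y where "y = (\<Sum>j=1..k. p j *\<^sub>R \<nu> j)"
  define g where
    "g l = support_fun K (u + (\<Sum>j=1..k. l j *\<^sub>R \<nu> j)) - ereal (\<Sum>j=1..k. l j * p j)" for l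
  \<comment> \<open>Restriction to \<open>{1..k}\<close> makes these functions extensional, so that
    they are elements of the index set of the infimum.\<close>
  define coords where "coords w = (\<lambda>j\<in>{1..k}. w \<bullet> \<nu> j)" for w
  note inner_sum = orthonormal_family_inner_sum[OF \<nu>]
  have "L x = y \<longleftrightarrow> (\<forall>j\<in>{1..k}. x \<bullet> \<nu> j = p j)" for x
  proof
    assume "L x = y"
    then show "\<forall>j\<in>{1..k}. x \<bullet> \<nu> j = p j"
      using inner_sum[of _ "\<lambda>j. x \<bullet> \<nu> j"] inner_sum[of _ p] by (simp add: L_def y_def)
  qed (simp add: L_def y_def)
  then have slice: "iter_slice K k \<nu> p = K \<inter> {x. L x = y}"
    by (auto simp: iter_slice_def)
  have "linear L"
    unfolding L_def
    by (intro linear_compose_sum ballI linearI) (auto simp: inner_add_left scaleR_add_left)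
  moreover have "L x \<bullet> w = x \<bullet> L w" for x w
    by (simp add: L_def inner_sum_left inner_sum_right inner_commute mult.commute)
  ultimately have "slicing_support_fun K k \<nu> u p =
      (INF w. support_fun K (u + L w) - ereal (y \<bullet> w))"
    unfolding slicing_support_fun_def slice by (rule support_fun_fiber[OF K])
  \<comment> \<open>Both \<open>L w\<close> and \<open>y \<bullet> w\<close> depend on
    \<open>w\<close> only through its coordinates along the directions.\<close>
  also have "\<dots> = (INF w. g (coords w))"
    by (simp add: g_def coords_def L_def y_def inner_sum_left inner_commute[of "\<nu> _"] mult.commute)
  also have "\<dots> = (INF l \<in> range coords. g l)"
    by (simp add: image_image)
  \<comment> \<open>By orthonormality every coefficient tuple is attained, namely at the
    corresponding linear combination.\<close>
  also have "range coords = {1..k} \<rightarrow>\<^sub>E UNIV"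
  proof (intro equalityI subsetI)
    fix l :: "nat \<Rightarrow> real" assume "l \<in> {1..k} \<rightarrow>\<^sub>E UNIV"
    then have "l = coords (\<Sum>j=1..k. l j *\<^sub>R \<nu> j)"
      using inner_sum[of _ l] by (auto simp: coords_def PiE_def extensional_def)
    then show "l \<in> range coords" by blast
  qed (auto simp: coords_def)
  finally show ?thesis by (simp add: g_def)
qed

theorem theorem8:
  fixes K :: "(real ^ 'n) set" and \<nu> :: "nat \<Rightarrow> real ^ 'n" and k :: nat
  assumes "convex_body K"
    and "1 \<le> k" and "k \<le> CARD('n) - 1"
    and "orthonormal_family {1..k} \<nu>"
  shows "(\<forall>u \<in> slice_space k \<nu>. \<forall>p :: nat \<Rightarrow> real.
            slicing_support_fun K k \<nu> u p =
              (INF l \<in> {1..k} \<rightarrow>\<^sub>E (UNIV :: real set).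
                 support_fun K (u + (\<Sum>j=1..k. l j *\<^sub>R \<nu> j)) - ereal (\<Sum>j=1..k. l j * p j)))
       \<and> (2 \<le> k \<longrightarrow>
          (\<forall>u \<in> slice_space k \<nu>. \<forall>p :: nat \<Rightarrow> real.
            slicing_support_fun K k \<nu> u p =
              (INF l \<in> (UNIV :: real set).
                 slicing_support_fun K (k - 1) \<nu> (u + l *\<^sub>R \<nu> k) p - ereal (l * p k))))"
proof -
  have K: "compact K" "convex K"
    using assms(1) by (auto simp: convex_body_def)
  obtain m where "k = Suc m"
    using assms(2) by (cases k) auto
  then show ?thesis
    using slicing_support_fun_eq_INF[OF K assms(4)] slicing_support_fun_Suc[OF K] by auto
qed

end
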